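(* Let $D$ be a non-square positive integer, and let $F_D=\{(x,y)\in\mathbb{Z}^2 : x^2-Dy^2=1\}$. Then for any real number $\lambda>0$, $$Q_{F_D}(\lambda)=\begin{cases}\varnothing & \text{if }\lambda<1,\\ \displaystyle\bigcup_{i,j\in\{1,-1\}}\{(iu(x),jv(x))\in\mathbb{Z}^2 : x\in\mathbb{Z}_{\ge 0},\ x\le g(\lambda)\} & \text{if }\lambda\ge 1,\end{cases}$$ where $g=f^{-1}$ and $f=u+v$. Consequently, $$|Q_{F_D}(\lambda)|=\begin{cases}0 & \text{if }\lambda<1,\\ 2+4\lfloor g(\lambda)\rfloor & \text{if }\lambda\ge 1.\end{cases}$$
   Context: Let $D$ be a non-square positive integer. The fundamental solution $(\alpha,\beta)$ of the Pell equation $x^2-Dy^2=1$ is the solution in positive integers with the smallest value of $x+y\sqrt{D}$ among all positive integer solutions. Define $u:[0,\infty)\to[1,\infty)$ and $v:[0,\infty)\to[0,\infty)$ by $$u(x)=\tfrac12\left\{(\alpha+\beta\sqrt{D})^x+(\alpha-\beta\sqrt{D})^x\right\},\qquad v(x)=\tfrac{1}{2\sqrt{D}}\left\{(\alpha+\beta\sqrt{D})^x-(\alpha-\beta\sqrt{D})^x\right\}.$$ The function $f:[0,\infty)\to[1,\infty)$, $f=u+v$, is a strictly increasing bijection, and $g:=f^{-1}:[1,\infty)\to[0,\infty)$ denotes its inverse. For any set $G\subseteq\mathbb{Z}^2$ and real $\lambda>0$, $Q_G(\lambda):=\{(x,y)\in G : |x|+|y|\le\lambda\}$. $\lfloor\cdot\rfloor$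 is the floor function and $|\cdot|$ applied to a set is its cardinality. *)

theory Defs
  imports Complex_Main "HOL-Computational_Algebra.Nth_Powers"
begin

definition pell_solutions :: "nat \<Rightarrow> (int \<times> int) set" where
  "pell_solutions D = {(x, y). x\<^sup>2 - int D * y\<^sup>2 = 1}"

text \<open>For non-square \<open>D\<close> the minimum is attained, by exactly one positive solution.\<close>

definition pell_fundamental :: "nat \<Rightarrow> int \<times> int" where
  "pell_fundamental D =
     arg_min_on (\<lambda>(x, y). real_of_int x + real_of_int y * sqrt (real D))
       {(x, y) \<in> pell_solutions D. x > 0 \<and> y > 0}"

definition pell_alpha :: "nat \<Rightarrow> real" where
  "pell_alpha D = real_of_int (fst (pell_fundamental D))"

definition pell_beta :: "nat \<Rightarrow> real" where
  "pell_beta D = real_of_int (snd (pell_fundamental D))"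

text \<open>The functions \<open>u\<close>, \<open>v\<close>, \<open>f\<close> are of interest on \<open>{0..}\<close> only. For non-square \<open>D\<close> both bases
  are positive, being mutually inverse, so that \<open>powr\<close> is the usual real power.\<close>

definition pell_u :: "nat \<Rightarrow> real \<Rightarrow> real" where
  "pell_u D x = 1 / 2 *
     ((pell_alpha D + pell_beta D * sqrt (real D)) powr x +
      (pell_alpha D - pell_beta D * sqrt (real D)) powr x)"

definition pell_v :: "nat \<Rightarrow> real \<Rightarrow> real" where
  "pell_v D x = 1 / (2 * sqrt (real D)) *
     ((pell_alpha D + pell_beta D * sqrt (real D)) powr x -
      (pell_alpha D - pell_beta D * sqrt (real D)) powr x)"

definition pell_f :: "nat \<Rightarrow> real \<Rightarrow> real" where
  "pell_f D x = pell_u D x + pell_v D x"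

text \<open>The inverse of the bijection \<open>pell_f D\<close> from \<open>{0..}\<close> to \<open>{1..}\<close>; only its values on
  \<open>{1..}\<close> are meaningful.\<close>

definition pell_g :: "nat \<Rightarrow> real \<Rightarrow> real" where
  "pell_g D = inv_into {0..} (pell_f D)"

definition Q :: "(int \<times> int) set \<Rightarrow> real \<Rightarrow> (int \<times> int) set" where
  "Q G r = {(x, y) \<in> G. real_of_int (\<bar>x\<bar> + \<bar>y\<bar>) \<le> r}"

end

theory Submission
  imports Defs "HOL-Analysis.Kronecker_Approximation_Theorem"
begin

text \<open>
  Existence of a solution is Lagrange's pigeonhole argument: infinitely many fractions \<open>h/k\<close> satisfy
  \<open>\<bar>\<surd>D - h/k\<bar> < 1/k\<^sup>2\<close>, so their norms \<open>h\<^sup>2 - D k\<^sup>2\<close> are bounded, and the quotient of two of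
  equal norm \<open>n\<close> that agree modulo \<open>n\<close> is a unit. Dividing by the fundamental unit
  \<open>\<epsilon> = \<alpha> + \<beta> \<surd>D\<close> lowers the second coordinate, so every nonnegative solution is some
  \<open>(u n, v n)\<close>. Up to signs, the solutions with \<open>\<bar>x\<bar> + \<bar>y\<bar>\<close> at most \<open>\<lambda>\<close> are then those with \<open>f n \<le> \<lambda>\<close>, that
  is \<open>n \<le> g \<lambda>\<close>; signs give two solutions for \<open>n = 0\<close> and four for each \<open>n > 0\<close>.
\<close>

section \<open>Irrationality and bounded norms\<close>

lemma nonsquare_sqrt_irrational:
  fixes D :: nat
  assumes "\<not> is_square D"
  shows "sqrt (real D) \<notin> \<rat>"
proof
  assume "sqrt (real D) \<in> \<rat>"
  then obtain m n :: nat where n: "n \<noteq> 0" and mn: "\<bar>sqrt (real D)\<bar> = real m / real n"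
    by (rule Rats_abs_nat_div_natE)
  then have "sqrt (real D) * real n = real m"
    by (simp add: field_simps)
  then have "(sqrt (real D) * real n)\<^sup>2 = (real m)\<^sup>2"
    by simp
  then have "real (n\<^sup>2 * D) = real (m\<^sup>2)"
    by (simp add: power_mult_distrib mult.commute)
  then have "n\<^sup>2 * D = m\<^sup>2"
    by (simp only: of_nat_eq_iff)
  then have "is_square (n\<^sup>2 * D)"
    by simp
  then have "is_square D"
    using n by (simp add: is_nth_power_mult_cancel_left)
  with assms show False by simp
qed

text \<open>Multiplicativity of the norm for \<open>(a + b * sqrt D) * (c - d * sqrt D)\<close>. The
  conjugate in the second factor turns products into quotients up to the norm, as both existence and
  descent require.\<close>

lemma brahmagupta_conj:
  fixes a b c d D :: "'a :: comm_ring_1"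
  shows "(a * c - D * b * d)\<^sup>2 - D * (c * b - a * d)\<^sup>2 = (a\<^sup>2 - D * b\<^sup>2) * (c\<^sup>2 - D * d\<^sup>2)"
  by (simp add: power2_eq_square algebra_simps)

lemma approx_set_sqrt_norm_le:
  assumes "(h, k) \<in> approx_set (sqrt (real D))"
  shows "\<bar>real_of_int (h\<^sup>2 - int D * k\<^sup>2)\<bar> \<le> 1 + 2 * sqrt (real D)"
proof -
  define s where "s = sqrt (real D)"
  have s: "s \<ge> 0" "s\<^sup>2 = real D" by (simp_all add: s_def)
  from assms have k: "real_of_int k \<ge> 1" and hk: "\<bar>s - h / k\<bar> < 1 / k\<^sup>2"
    by (auto simp: approx_set_def s_def)
  \<comment> \<open>Substituting \<open>h = k * s - e\<close> leaves
    \<open>e\<^sup>2 - 2 * s * e * k\<close> as the norm, and the approximation gives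
    \<open>\<bar>e\<bar> * k \<le> 1\<close>.\<close>
  define e where "e = k * s - h"
  have "\<bar>e\<bar> = \<bar>s - h / k\<bar> * k"
    using k by (simp add: e_def abs_mult[symmetric] abs_if field_simps)
  also have "\<dots> < 1 / k\<^sup>2 * k"
    using hk k by (intro mult_strict_right_mono) auto
  also have "\<dots> = 1 / k"
    using k by (simp add: power2_eq_square)
  finally have e: "\<bar>e\<bar> * k \<le> 1"
    using k by (simp add: field_simps)
  have e1: "\<bar>e\<bar> \<le> 1"
    using mult_left_mono[OF k, of "\<bar>e\<bar>"] e by simp
  have "real_of_int (h\<^sup>2 - int D * k\<^sup>2) = e * e - 2 * s * (e * k)"
    by (simp add: e_def s(2)[symmetric] power2_eq_square algebra_simps)
  also have "\<bar>\<dots>\<bar> \<le> \<bar>e\<bar> * \<bar>e\<bar> + 2 * s * (\<bar>e\<bar> * k)"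
    using s(1) k abs_triangle_ineq4[of "e * e" "2 * s * (e * k)"] by (simp add: abs_mult)
  also have "\<dots> \<le> 1 * 1 + 2 * s * 1"
    using s(1) k e e1 by (intro add_mono mult_mono) auto
  finally show ?thesis by (simp add: s_def)
qed

section \<open>Existence of a positive solution\<close>

locale nonsquare =
  fixes D :: nat
  assumes nonsquare: "\<not> is_square D"
begin

abbreviation "s \<equiv> sqrt (real D)"

lemma D_gt_1: "D > 1"
proof (rule ccontr)
  assume "\<not> D > 1"
  then have "D = 0 \<or> D = 1" by auto
  then show False using nonsquare by (auto simp: is_nth_power_0_iff)
qed

lemma s_gt_1: "s > 1"
  using D_gt_1 by simp

text \<open>On this branch of the hyperbola the second coordinate grows with the first, so
  minimising \<open>x + y * s\<close> amounts to minimising \<open>x\<close>.\<close>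

lemma pell_coord_mono:
  assumes "(a, b) \<in> pell_solutions D" "(c, d) \<in> pell_solutions D" "a \<le> c" "a > 0" "b \<ge> 0" "d \<ge> 0"
  shows "b \<le> d"
proof -
  have "a\<^sup>2 \<le> c\<^sup>2"
    using assms by (intro power_mono) auto
  then have "int D * b\<^sup>2 \<le> int D * d\<^sup>2"
    using assms(1,2) unfolding pell_solutions_def mem_Collect_eq case_prod_conv by linarith
  then have "b\<^sup>2 \<le> d\<^sup>2"
    using D_gt_1 by simp
  then show ?thesis
    using assms power2_le_imp_le by blast
qed

lemma ex_positive_solution: "\<exists>a b. (a, b) \<in> pell_solutions D \<and> a > 0 \<and> b > 0"
proof -
  define A where "A = approx_set s"
  define B where "B = \<lceil>1 + 2 * s\<rceil>"
  define N where "N = (\<lambda>(h, k). h\<^sup>2 - int D * k\<^sup>2)"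
  \<comment> \<open>The pigeonholes: the norm together with both residues modulo it. Bounded norms
    leave only finitely many.\<close>
  define \<phi> where "\<phi> p = (N p, fst p mod N p, snd p mod N p)" for p
  have "infinite A"
    unfolding A_def using nonsquare_sqrt_irrational[OF nonsquare] rational_iff_finite_approx_set by blast
  have N_nz: "N p \<noteq> 0" if "p \<in> A" for p
  proof
    assume "N p = 0"
    obtain h k where p: "p = (h, k)" by force
    have k: "k > 0" using that by (auto simp: A_def approx_set_def p)
    have "real_of_int (h\<^sup>2) = real_of_int (int D * k\<^sup>2)"
      using \<open>N p = 0\<close> by (simp add: N_def p)
    then have "sqrt ((real_of_int h)\<^sup>2) = sqrt (real D * (real_of_int k)\<^sup>2)"
      by simp
    then have "\<bar>real_of_int h\<bar> = s * k"
      using k by (simp add: real_sqrt_mult)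
    then have "s = \<bar>real_of_int h\<bar> / k"
      using k by (simp add: field_simps)
    then have "s \<in> \<rat>" by simp
    with nonsquare_sqrt_irrational[OF nonsquare] show False by simp
  qed
  have N_le: "\<bar>N p\<bar> \<le> B" if "p \<in> A" for p
  proof -
    obtain h k where p: "p = (h, k)" by force
    have "real_of_int \<bar>N p\<bar> \<le> 1 + 2 * s"
      using approx_set_sqrt_norm_le[of h k D] that by (simp add: A_def p N_def)
    then show ?thesis unfolding B_def by linarith
  qed
  have "\<phi> ` A \<subseteq> {-B..B} \<times> {-B..B} \<times> {-B..B}"
  proof
    fix q assume "q \<in> \<phi> ` A"
    then obtain p where p: "p \<in> A" "q = \<phi> p" by auto
    have "\<bar>x mod N p\<bar> \<le> B" for x
      using abs_mod_less[OF N_nz[OF p(1)], of x] N_le[OF p(1)] by linarith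
    then show "q \<in> {-B..B} \<times> {-B..B} \<times> {-B..B}"
      using N_le[OF p(1)] by (auto simp: p(2) \<phi>_def abs_le_iff minus_le_iff)
  qed
  then have "finite (\<phi> ` A)"
    by (rule finite_subset) auto
  from pigeonhole_infinite[OF \<open>infinite A\<close> this]
  obtain p where p: "p \<in> A" "infinite {q \<in> A. \<phi> q = \<phi> p}" by blast
  have "{q \<in> A. \<phi> q = \<phi> p} - {p} \<noteq> {}"
    using p(2) by (metis finite.emptyI infinite_remove)
  then obtain q where q: "q \<in> A" "\<phi> q = \<phi> p" "q \<noteq> p" by auto
  obtain h k where hk: "p = (h, k)" by force
  obtain h' k' where hk': "q = (h', k')" by force
  define n where "n = N p"
  have n: "n \<noteq> 0" "h\<^sup>2 - int D * k\<^sup>2 = n" "h'\<^sup>2 - int D * k'\<^sup>2 = n"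
    using N_nz[OF p(1)] q(2) by (simp_all add: n_def hk hk' N_def \<phi>_def)
  have "n dvd h' - h" "n dvd k' - k"
    using q(2) unfolding mod_eq_dvd_iff[symmetric] by (auto simp: n_def hk hk' \<phi>_def)
  then obtain x y where "h' - h = n * x" "k' - k = n * y"
    by (elim dvdE)
  then have xy: "h' = h + n * x" "k' = k + n * y"
    by simp_all
  have k: "k > 0" "k' > 0"
    using p(1) q(1) by (auto simp: A_def approx_set_def hk hk')
  \<comment> \<open>\<open>X + Y * s\<close> is the quotient
    \<open>(h + k * s) / (h' + k' * s)\<close>; the congruences modulo \<open>n\<close> make its
    coordinates integers.\<close>
  define X where "X = 1 + h * x - int D * k * y"
  define Y where "Y = x * k - h * y"
  have X: "h * h' - int D * k * k' = n * X"
  proof -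
    have "h * h' - int D * k * k' = (h\<^sup>2 - int D * k\<^sup>2) + n * (h * x - int D * k * y)"
      by (simp add: xy power2_eq_square algebra_simps)
    then show ?thesis by (simp add: n(2) X_def algebra_simps)
  qed
  have Y: "h' * k - h * k' = n * Y"
    by (simp add: xy Y_def algebra_simps)
  have "n\<^sup>2 * (X\<^sup>2 - int D * Y\<^sup>2) = n\<^sup>2 * 1"
    using brahmagupta_conj[of h h' "int D" k k', unfolded X Y n]
    by (simp add: power2_eq_square algebra_simps)
  then have XY: "X\<^sup>2 - int D * Y\<^sup>2 = 1"
    using n(1) by simp
  \<comment> \<open>If \<open>Y = 0\<close>, the two fractions are equal, and equal norms then force
    equal denominators, contradicting \<open>q \<noteq> p\<close>.\<close>
  have "Y \<noteq> 0"
  proof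
    assume "Y = 0"
    then have eq: "h' * k = h * k'" using Y by simp
    have "k\<^sup>2 * n = (h' * k)\<^sup>2 - int D * k\<^sup>2 * k'\<^sup>2"
      by (simp flip: n(3) add: power2_eq_square algebra_simps)
    also have "\<dots> = k'\<^sup>2 * n"
      by (simp flip: n(2) add: eq power2_eq_square algebra_simps)
    finally have "k\<^sup>2 = k'\<^sup>2" using n(1) by simp
    then have "k = k'" using k by (simp add: power2_eq_iff_nonneg)
    with eq k q(3) show False by (simp add: hk hk')
  qed
  moreover have "X \<noteq> 0"
  proof
    assume "X = 0"
    then have "int D * Y\<^sup>2 = -1" using XY by simp
    moreover have "int D * Y\<^sup>2 \<ge> 0" by simp
    ultimately show False by linarith
  qed
  ultimately show ?thesis
    using XY by (intro exI[of _ "\<bar>X\<bar>"] exI[of _ "\<bar>Y\<bar>"]) (auto simp: pell_solutions_def)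
qed

section \<open>The fundamental solution and its unit\<close>

definition \<alpha> :: int where "\<alpha> = fst (pell_fundamental D)"
definition \<beta> :: int where "\<beta> = snd (pell_fundamental D)"

text \<open>\<open>arg_min_on\<close> is a choice operator, so a minimiser must be exhibited first:
  a positive solution with least first coordinate, by \<open>pell_coord_mono\<close>.\<close>

lemma fundamental:
  shows fundamental_solution: "(\<alpha>, \<beta>) \<in> pell_solutions D"
    and alpha_pos: "\<alpha> > 0" and beta_pos: "\<beta> > 0"
    and fundamental_le:
      "\<And>a b. (a, b) \<in> pell_solutions D \<Longrightarrow> a > 0 \<Longrightarrow> b > 0 \<Longrightarrow> \<alpha> + \<beta> * s \<le> a + b * s"
proof -
  define S where "S = {(x, y) \<in> pell_solutions D. x > 0 \<and> y > 0}"
  define F where "F = (\<lambda>(x, y). real_of_int x + real_of_int y * s)"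
  have "\<exists>p. p \<in> S"
    using ex_positive_solution by (auto simp: S_def)
  then obtain p where p: "p \<in> S" "\<And>q. q \<in> S \<Longrightarrow> nat (fst p) \<le> nat (fst q)"
    using ex_has_least_nat[of "\<lambda>p. p \<in> S" _ "\<lambda>p. nat (fst p)"] by blast
  have "F p \<le> F q" if "q \<in> S" for q
  proof -
    obtain a b c d where ab: "p = (a, b)" and cd: "q = (c, d)" by force
    have "a \<le> c" using p(2)[OF that] p(1) that by (auto simp: S_def ab cd)
    moreover from this have "b \<le> d"
      using p(1) that pell_coord_mono[of a b c d] by (auto simp: S_def ab cd)
    ultimately show ?thesis
      using s_gt_1 by (auto simp: F_def ab cd intro!: add_mono mult_right_mono)
  qed
  with p(1) have "is_arg_min F (\<lambda>x. x \<in> S) p"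
    by (simp add: is_arg_min_linorder)
  then have "is_arg_min F (\<lambda>x. x \<in> S) (arg_min_on F S)"
    unfolding arg_min_on_def arg_min_def by (rule someI)
  moreover have "arg_min_on F S = (\<alpha>, \<beta>)"
    by (simp add: \<alpha>_def \<beta>_def pell_fundamental_def S_def F_def)
  ultimately have *: "(\<alpha>, \<beta>) \<in> S" "\<And>q. q \<in> S \<Longrightarrow> F (\<alpha>, \<beta>) \<le> F q"
    by (auto simp: is_arg_min_linorder)
  show "(\<alpha>, \<beta>) \<in> pell_solutions D" "\<alpha> > 0" "\<beta> > 0"
    using *(1) by (auto simp: S_def)
  show "\<alpha> + \<beta> * s \<le> a + b * s" if "(a, b) \<in> pell_solutions D" "a > 0" "b > 0" for a b
    using *(2)[of "(a, b)"] that by (simp add: S_def F_def)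
qed

definition \<epsilon> :: real where "\<epsilon> = \<alpha> + \<beta> * s"

lemma alpha_beta_norm: "(real_of_int \<alpha>)\<^sup>2 - D * (real_of_int \<beta>)\<^sup>2 = 1"
proof -
  have "real_of_int (\<alpha>\<^sup>2 - int D * \<beta>\<^sup>2) = 1"
    using fundamental_solution by (simp only: pell_solutions_def mem_Collect_eq case_prod_conv of_int_1)
  then show ?thesis by simp
qed

lemma epsilon_conj: "\<epsilon> * (\<alpha> - \<beta> * s) = 1"
  using alpha_beta_norm by (simp add: \<epsilon>_def power2_eq_square algebra_simps)

lemma epsilon_gt_1: "\<epsilon> > 1"
proof -
  have "real_of_int \<alpha> \<ge> 1" "\<beta> * s > 0"
    using alpha_pos beta_pos s_gt_1 by auto
  then show ?thesis by (simp add: \<epsilon>_def)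
qed

lemma conj_eq_inverse: "\<alpha> - \<beta> * s = inverse \<epsilon>"
  using epsilon_conj epsilon_gt_1 by (simp add: field_simps)

section \<open>Properties of u and v\<close>

text \<open>Since the conjugate of \<open>\<epsilon>\<close> is its inverse, \<open>u\<close> and
  \<open>s * v\<close> are the hyperbolic cosine and sine of
  \<open>x * ln \<epsilon>\<close>.\<close>

lemma u_eq: "pell_u D x = (\<epsilon> powr x + inverse (\<epsilon> powr x)) / 2"
  and v_eq: "pell_v D x = (\<epsilon> powr x - inverse (\<epsilon> powr x)) / (2 * s)"
  unfolding pell_u_def pell_v_def pell_alpha_def pell_beta_def
    \<alpha>_def[symmetric] \<beta>_def[symmetric] conj_eq_inverse
  by (simp_all add: \<epsilon>_def[symmetric] inverse_powr)

lemma u_plus_v: "pell_u D x + pell_v D x * s = \<epsilon> powr x"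
  and u_minus_v: "pell_u D x - pell_v D x * s = inverse (\<epsilon> powr x)"
  using s_gt_1 by (simp_all add: u_eq v_eq field_simps)

lemma pell_uv_norm: "(pell_u D x)\<^sup>2 - D * (pell_v D x)\<^sup>2 = 1"
proof -
  have "(pell_u D x)\<^sup>2 - D * (pell_v D x)\<^sup>2 = (pell_u D x + pell_v D x * s) * (pell_u D x - pell_v D x * s)"
    by (simp add: power2_eq_square algebra_simps)
  also have "\<dots> = 1"
    using epsilon_gt_1 by (simp add: u_plus_v u_minus_v)
  finally show ?thesis .
qed

text \<open>Multiplication of \<open>u + v * s\<close> by \<open>\<epsilon>\<close> in coordinates.
  It yields integrality by induction and undoes one descent step.\<close>

lemma pell_u_Suc: "pell_u D (real (Suc n)) = \<alpha> * pell_u D n + D * \<beta> * pell_v D n"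
  and pell_v_Suc: "pell_v D (real (Suc n)) = \<beta> * pell_u D n + \<alpha> * pell_v D n"
proof -
  let ?p = "\<epsilon> powr n"
  have 1: "\<epsilon> powr (real (Suc n)) = ?p * (\<alpha> + \<beta> * s)"
    using epsilon_gt_1 by (simp add: powr_add \<epsilon>_def mult.commute add.commute)
  then have 2: "inverse (\<epsilon> powr (real (Suc n))) = inverse ?p * (\<alpha> - \<beta> * s)"
    by (simp add: conj_eq_inverse \<epsilon>_def)
  have v: "s * pell_v D n = (?p - inverse ?p) / 2"
    using s_gt_1 by (simp add: v_eq)
  have "D * pell_v D n = s * (s * pell_v D n)"
    by simp
  then have "D * \<beta> * pell_v D n = \<beta> * s * ((?p - inverse ?p) / 2)"
    unfolding v by (simp add: mult_ac)
  \<comment> \<open>Rule \<open>2\<close> must rewrite before \<open>1\<close>, whose left side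
    occurs inside that of \<open>2\<close>.\<close>
  then show "pell_u D (real (Suc n)) = \<alpha> * pell_u D n + D * \<beta> * pell_v D n"
    unfolding u_eq 2 unfolding 1 by (simp add: algebra_simps add_divide_distrib diff_divide_distrib)
  show "pell_v D (real (Suc n)) = \<beta> * pell_u D n + \<alpha> * pell_v D n"
    unfolding u_eq v_eq 2 unfolding 1 using s_gt_1
    by (simp add: field_simps) (simp add: diff_divide_distrib)
qed

lemma pell_u_0 [simp]: "pell_u D 0 = 1" and pell_v_0 [simp]: "pell_v D 0 = 0"
  using epsilon_gt_1 by (simp_all add: u_eq v_eq)

lemma pell_v_strict_mono: "strict_mono (pell_v D)"
proof (rule strict_monoI)
  fix x y :: real assume "x < y"
  then have "\<epsilon> powr x < \<epsilon> powr y"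
    using epsilon_gt_1 by simp
  moreover from this have "inverse (\<epsilon> powr y) < inverse (\<epsilon> powr x)"
    using epsilon_gt_1 by (intro less_imp_inverse_less) auto
  ultimately show "pell_v D x < pell_v D y"
    using s_gt_1 by (simp add: v_eq divide_strict_right_mono)
qed

lemma pell_v_nonneg: "x \<ge> 0 \<Longrightarrow> pell_v D x \<ge> 0"
  using strict_mono_less_eq[OF pell_v_strict_mono, of 0 x] by simp

lemma pell_u_pos: "pell_u D x > 0"
  using epsilon_gt_1 by (simp add: u_eq add_pos_pos)

lemma pell_uv_int:
  obtains a b where "real_of_int a = pell_u D (real n)" "real_of_int b = pell_v D (real n)" "a > 0" "b \<ge> 0"
proof -
  have "\<exists>a b. real_of_int a = pell_u D (real n) \<and> real_of_int b = pell_v D (real n)"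
  proof (induction n)
    case 0
    show ?case by (intro exI[of _ 1] exI[of _ 0]) simp
  next
    case (Suc n)
    then obtain a b where "real_of_int a = pell_u D n" "real_of_int b = pell_v D n" by auto
    then show ?case
      unfolding pell_u_Suc pell_v_Suc
      by (intro exI[of _ "\<alpha> * a + int D * \<beta> * b"] exI[of _ "\<beta> * a + \<alpha> * b"]) simp
  qed
  then obtain a b where ab: "real_of_int a = pell_u D n" "real_of_int b = pell_v D n" by auto
  have "real_of_int a > 0" "real_of_int b \<ge> 0"
    unfolding ab using pell_u_pos pell_v_nonneg by auto
  then show thesis using ab that by auto
qed

section \<open>Descent by the fundamental unit\<close>

lemma nonneg_solution_is_power:
  assumes "(a, b) \<in> pell_solutions D" "a > 0" "b \<ge> 0"
  shows "\<exists>n. real_of_int a = pell_u D (real n) \<and> real_of_int b = pell_v D (real n)"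
  using assms
proof (induction "nat b" arbitrary: a b rule: less_induct)
  case less
  note ab = less.prems
  have norm: "a\<^sup>2 - int D * b\<^sup>2 = 1" "\<alpha>\<^sup>2 - int D * \<beta>\<^sup>2 = 1"
    using ab(1) fundamental_solution by (simp_all add: pell_solutions_def)
  show ?case
  proof (cases "b = 0")
    case True
    then have "a = 1" using norm ab(2) by (simp add: power2_eq_1_iff)
    then show ?thesis using True by (intro exI[of _ 0]) simp
  next
    case False
    then have b: "b > 0" using ab(3) by simp
    \<comment> \<open>Otherwise \<open>a \<le> \<alpha>\<close> by monotonicity of coordinates, and
      \<open>a + b * s\<close> would undercut the minimum.\<close>
    have "\<beta> \<le> b"
    proof (rule ccontr)
      assume "\<not> \<beta> \<le> b"
      then have less: "real_of_int b < real_of_int \<beta>" by simp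
      have "a \<le> \<alpha>"
      proof (rule ccontr)
        assume "\<not> a \<le> \<alpha>"
        then show False
          using pell_coord_mono[OF fundamental_solution ab(1)] alpha_pos beta_pos b \<open>\<not> \<beta> \<le> b\<close> by simp
      qed
      then have "real_of_int a \<le> real_of_int \<alpha>" by simp
      moreover have "b * s < \<beta> * s"
        using less s_gt_1 by (intro mult_strict_right_mono) auto
      ultimately show False
        using fundamental_le[OF ab(1,2) b] by linarith
    qed
    \<comment> \<open>\<open>c + d * s\<close> is \<open>(a + b * s) / \<epsilon>\<close>, that is
      \<open>(a + b * s) * (\<alpha> - \<beta> * s)\<close>.\<close>
    define c where "c = a * \<alpha> - int D * b * \<beta>"
    define d where "d = \<alpha> * b - a * \<beta>"
    have cd: "(c, d) \<in> pell_solutions D"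
      using brahmagupta_conj[of a \<alpha> "int D" b \<beta>] norm by (simp add: pell_solutions_def c_def d_def)
    \<comment> \<open>Positivity of \<open>c\<close>: after squaring, both norm equations reduce the
      claim to \<open>a\<^sup>2 + \<alpha>\<^sup>2 > 1\<close>.\<close>
    have "int D * b * \<beta> < a * \<alpha>"
    proof (rule power2_less_imp_less)
      have "(int D * b * \<beta>)\<^sup>2 = (a\<^sup>2 - 1) * (\<alpha>\<^sup>2 - 1)"
        using norm by (simp add: power_mult_distrib power2_eq_square[of "int D"] algebra_simps)
      also have "\<dots> < (a * \<alpha>)\<^sup>2"
      proof -
        have "a\<^sup>2 > 0" using ab(2) by simp
        moreover have "int D * \<beta>\<^sup>2 > 0" using beta_pos D_gt_1 by simp
        ultimately have "a\<^sup>2 + \<alpha>\<^sup>2 > 1" using norm(2) by linarith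
        then show ?thesis by (simp add: algebra_simps power_mult_distrib)
      qed
      finally show "(int D * b * \<beta>)\<^sup>2 < (a * \<alpha>)\<^sup>2" .
    qed (use ab alpha_pos in simp)
    then have "c > 0" by (simp add: c_def)
    \<comment> \<open>Nonnegativity of \<open>d\<close>; eliminating \<open>a\<close> and
      \<open>\<alpha>\<close> from the squares leaves exactly
      \<open>\<beta>\<^sup>2 \<le> b\<^sup>2\<close>.\<close>
    have "a * \<beta> \<le> \<alpha> * b"
    proof (rule power2_le_imp_le)
      have "\<beta>\<^sup>2 \<le> b\<^sup>2"
        using \<open>\<beta> \<le> b\<close> beta_pos by (intro power_mono) auto
      have "(a * \<beta>)\<^sup>2 = (1 + int D * b\<^sup>2) * \<beta>\<^sup>2"
        using norm(1) by (simp add: power_mult_distrib algebra_simps)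
      also have "\<dots> \<le> (1 + int D * \<beta>\<^sup>2) * b\<^sup>2"
        using \<open>\<beta>\<^sup>2 \<le> b\<^sup>2\<close> by (simp add: algebra_simps)
      also have "\<dots> = (\<alpha> * b)\<^sup>2"
        using norm(2) by (simp add: power_mult_distrib algebra_simps)
      finally show "(a * \<beta>)\<^sup>2 \<le> (\<alpha> * b)\<^sup>2" .
    qed (use alpha_pos b in simp)
    then have "d \<ge> 0" by (simp add: d_def)
    \<comment> \<open>A rearrangement of \<open>d < b\<close>, so the descent terminates. It rests
      on \<open>(\<alpha> - 1)\<^sup>2 \<le> \<alpha>\<^sup>2 - 1\<close> and
      \<open>int D * b\<^sup>2 < a\<^sup>2\<close>.\<close>
    have "(\<alpha> - 1) * b < a * \<beta>"
    proof (rule power2_less_imp_less)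
      have "((\<alpha> - 1) * b)\<^sup>2 \<le> (\<alpha>\<^sup>2 - 1) * b\<^sup>2"
        unfolding power_mult_distrib using alpha_pos
        by (intro mult_right_mono) (auto simp: power2_eq_square algebra_simps)
      also have "\<dots> = (int D * b\<^sup>2) * \<beta>\<^sup>2"
        using norm(2) by simp
      also have "\<dots> < a\<^sup>2 * \<beta>\<^sup>2"
        using norm(1) beta_pos by (intro mult_strict_right_mono) auto
      finally show "((\<alpha> - 1) * b)\<^sup>2 < (a * \<beta>)\<^sup>2"
        by (simp add: power_mult_distrib)
    qed (use ab beta_pos in simp)
    then have "nat d < nat b" using b by (simp add: d_def algebra_simps)
    from less.hyps[OF this cd \<open>c > 0\<close> \<open>d \<ge> 0\<close>]
    obtain n :: nat where n: "real_of_int c = pell_u D n" "real_of_int d = pell_v D n" by auto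
    \<comment> \<open>Multiplying back by \<open>\<epsilon>\<close> recovers \<open>(a, b)\<close>,
      at index \<open>Suc n\<close>.\<close>
    have "\<alpha> * c + int D * \<beta> * d = a * (\<alpha>\<^sup>2 - int D * \<beta>\<^sup>2)"
      by (simp add: c_def d_def power2_eq_square algebra_simps)
    then have "real_of_int (\<alpha> * c + int D * \<beta> * d) = a" using norm(2) by simp
    moreover have "\<beta> * c + \<alpha> * d = b * (\<alpha>\<^sup>2 - int D * \<beta>\<^sup>2)"
      by (simp add: c_def d_def power2_eq_square algebra_simps)
    then have "real_of_int (\<beta> * c + \<alpha> * d) = b" using norm(2) by simp
    ultimately have "real_of_int a = pell_u D (real (Suc n)) \<and> real_of_int b = pell_v D (real (Suc n))"
      unfolding pell_u_Suc pell_v_Suc n[symmetric] by simp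
    then show ?thesis by blast
  qed
qed

section \<open>Orbits under sign changes\<close>

text \<open>Absolute values encode all sign choices at once and match the size
  \<open>\<bar>x\<bar> + \<bar>y\<bar>\<close> used in \<open>Q\<close>.\<close>

definition orbit :: "nat \<Rightarrow> (int \<times> int) set" where
  "orbit n = {(a, b). real_of_int \<bar>a\<bar> = pell_u D (real n) \<and> real_of_int \<bar>b\<bar> = pell_v D (real n)}"

lemma pell_solutions_eq_orbits: "pell_solutions D = (\<Union>n. orbit n)"
proof (intro equalityI subsetI)
  fix p assume p: "p \<in> pell_solutions D"
  obtain a b where ab: "p = (a, b)" by force
  \<comment> \<open>The descent lemma needs a positive first coordinate, here
    \<open>\<bar>a\<bar>\<close>.\<close>
  have "a \<noteq> 0"
  proof
    assume "a = 0"
    then have "int D * b\<^sup>2 = -1" using p by (simp add: ab pell_solutions_def)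
    moreover have "int D * b\<^sup>2 \<ge> 0" by simp
    ultimately show False by linarith
  qed
  moreover have "(\<bar>a\<bar>, \<bar>b\<bar>) \<in> pell_solutions D"
    using p by (simp add: ab pell_solutions_def)
  ultimately show "p \<in> (\<Union>n. orbit n)"
    using nonneg_solution_is_power[of "\<bar>a\<bar>" "\<bar>b\<bar>"] by (auto simp: ab orbit_def)
next
  fix p assume "p \<in> (\<Union>n. orbit n)"
  then obtain a b n where ab: "p = (a, b)" "real_of_int \<bar>a\<bar> = pell_u D (real n)"
    "real_of_int \<bar>b\<bar> = pell_v D (real n)" by (auto simp: orbit_def)
  have "real_of_int (a\<^sup>2 - int D * b\<^sup>2) = (real_of_int \<bar>a\<bar>)\<^sup>2 - D * (real_of_int \<bar>b\<bar>)\<^sup>2"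
    by simp
  also have "\<dots> = real_of_int 1"
    unfolding ab pell_uv_norm by simp
  finally show "p \<in> pell_solutions D"
    unfolding of_int_eq_iff by (simp add: ab(1) pell_solutions_def)
qed

text \<open>The orbit is \<open>{a, -a} \<times> {b, -b}\<close> with \<open>a > 0\<close>; the
  second factor collapses exactly when \<open>v\<close> vanishes, which by strict monotonicity
  happens only at \<open>n = 0\<close>.\<close>

lemma orbit_finite: "finite (orbit n)"
  and orbit_card: "card (orbit n) = (if n = 0 then 2 else 4)"
proof -
  obtain a b where ab: "real_of_int a = pell_u D (real n)" "real_of_int b = pell_v D (real n)"
    "a > 0" "b \<ge> 0" by (rule pell_uv_int)
  have eq: "orbit n = {a, -a} \<times> {b, -b}"
    unfolding orbit_def ab(1,2)[symmetric] of_int_eq_iff using ab(3,4) by auto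
  then show "finite (orbit n)" by simp
  have "b = 0 \<longleftrightarrow> n = 0"
    using strict_mono_eq[OF pell_v_strict_mono, of "real n" 0] ab(2) by auto
  then show "card (orbit n) = (if n = 0 then 2 else 4)"
    unfolding eq card_cartesian_product using ab(3) by (auto simp: card_insert_if)
qed

text \<open>The second coordinate alone determines the index, because \<open>v\<close> is
  injective.\<close>

lemma orbit_disjoint: "m \<noteq> n \<Longrightarrow> orbit m \<inter> orbit n = {}"
  using strict_mono_eq[OF pell_v_strict_mono, of "real m" "real n"] by (auto simp: orbit_def)

section \<open>The bijection f and its inverse\<close>

lemma pell_f_eq: "pell_f D x = ((1 + 1 / s) * \<epsilon> powr x + (1 - 1 / s) * inverse (\<epsilon> powr x)) / 2"
  by (simp add: pell_f_def u_eq v_eq algebra_simps add_divide_distrib diff_divide_distrib)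

lemma pell_f_strict_mono_on: "strict_mono_on {0..} (pell_f D)"
proof (rule strict_mono_onI)
  fix x y :: real assume xy: "x \<in> {0..}" "x < y"
  define p q A B where defs: "p = \<epsilon> powr x" "q = \<epsilon> powr y" "A = 1 + 1 / s" "B = 1 - 1 / s"
  have p: "p \<ge> 1" using xy epsilon_gt_1 by (simp add: defs ge_one_powr_ge_zero)
  have q: "p < q" using xy epsilon_gt_1 by (simp add: defs)
  have AB: "A > B" "B > 0" using s_gt_1 by (auto simp: defs)
  have "1 * 1 \<le> p * q" using p q by (intro mult_mono) auto
  then have "B / (p * q) \<le> B" using AB by (simp add: field_simps)
  \<comment> \<open>This factors the difference of the values of \<open>f\<close>, doubled. The
    growing term has the larger weight \<open>A > B\<close>, and \<open>p * q \<ge> 1\<close>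
    because the arguments are nonnegative.\<close>
  then have "0 < (q - p) * (A - B / (p * q))"
    using AB q by (intro mult_pos_pos) auto
  also have "\<dots> = (A * q + B * inverse q) - (A * p + B * inverse p)"
    using p q by (simp add: field_simps)
  finally have "A * p + B * inverse p < A * q + B * inverse q" by simp
  then show "pell_f D x < pell_f D y"
    unfolding pell_f_eq defs by (rule divide_strict_right_mono) simp
qed

lemma pell_f_image: "pell_f D ` {0..} = {1..}"
proof (intro equalityI subsetI)
  fix y assume "y \<in> pell_f D ` {0..}"
  then obtain x where x: "x \<ge> 0" "y = pell_f D x" by auto
  then have "pell_f D 0 \<le> y"
    using strict_mono_on_leD[OF pell_f_strict_mono_on, of 0 x] by simp
  then show "y \<in> {1..}" by (simp add: pell_f_def)
next
  fix y :: real assume y: "y \<in> {1..}"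
  \<comment> \<open>Chosen so that \<open>u\<close> alone already reaches \<open>y\<close> at
    \<open>b\<close>: half of \<open>\<epsilon> powr b\<close> is \<open>y\<close>. The intermediate
    value theorem then applies on \<open>{0..b}\<close>.\<close>
  define b where "b = log \<epsilon> (2 * y)"
  have b: "b \<ge> 0" using y epsilon_gt_1 by (simp add: b_def)
  have pb: "\<epsilon> powr b = 2 * y" using y epsilon_gt_1 by (simp add: b_def)
  have "y \<le> pell_u D b" using pb y by (simp add: u_eq)
  then have "y \<le> pell_f D b" using pell_v_nonneg[OF b] by (simp add: pell_f_def)
  moreover have "pell_f D 0 \<le> y" using y by (simp add: pell_f_def)
  moreover have "continuous_on {0..b} (pell_f D)"
    unfolding pell_f_eq using epsilon_gt_1 by (intro continuous_intros) auto
  ultimately obtain x where "x \<ge> 0" "pell_f D x = y"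
    using IVT'[of "pell_f D" 0 y b] b by auto
  then show "y \<in> pell_f D ` {0..}" by auto
qed

text \<open>\<open>r \<ge> 1\<close> puts \<open>r\<close> in the image of \<open>f\<close>, where
  \<open>inv_into\<close> is a genuine inverse; strict monotonicity then transfers the
  inequality.\<close>

lemma le_pell_g_iff:
  assumes "r \<ge> 1" "x \<ge> 0"
  shows "x \<le> pell_g D r \<longleftrightarrow> pell_f D x \<le> r"
proof -
  have r: "r \<in> pell_f D ` {0..}" using assms by (simp add: pell_f_image)
  have "pell_g D r \<in> {0..}" "pell_f D (pell_g D r) = r"
    unfolding pell_g_def by (rule inv_into_into[OF r], rule f_inv_into_f[OF r])
  then show ?thesis
    using strict_mono_on_less_eq[OF pell_f_strict_mono_on, of x "pell_g D r"] assms by simp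
qed

section \<open>Counting solutions of bounded size\<close>

text \<open>\<open>\<bar>a\<bar> + \<bar>b\<bar>\<close> is constant on \<open>orbit n\<close>, with
  value \<open>f n\<close>, so each orbit lies in \<open>Q\<close> entirely or not at all.\<close>

lemma Q_eq_orbits:
  assumes "r \<ge> 1"
  shows "Q (pell_solutions D) r = (\<Union>n \<in> {n. real n \<le> pell_g D r}. orbit n)"
  unfolding Q_def pell_solutions_eq_orbits
  by (auto simp: orbit_def le_pell_g_iff[OF assms] pell_f_def)

lemma card_Q:
  assumes "r \<ge> 1"
  shows "int (card (Q (pell_solutions D) r)) = 2 + 4 * \<lfloor>pell_g D r\<rfloor>"
proof -
  have g: "pell_g D r \<ge> 0"
    using assms by (simp add: le_pell_g_iff pell_f_def)
  define N where "N = nat \<lfloor>pell_g D r\<rfloor>"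
  have "{n. real n \<le> pell_g D r} = {..N}"
    using g by (auto simp: N_def le_nat_floor nat_le_iff le_floor_iff le_nat_iff)
  then have "card (Q (pell_solutions D) r) = (\<Sum>n\<le>N. card (orbit n))"
    unfolding Q_eq_orbits[OF assms]
    by (subst card_UN_disjoint) (auto simp: orbit_finite orbit_disjoint)
  \<comment> \<open>The index 0 contributes 2 and each of the remaining \<open>N\<close> indices
    contributes 4.\<close>
  also have "\<dots> = 2 + 4 * N"
    by (induction N) (simp_all add: orbit_card)
  finally show ?thesis using g by (simp add: N_def)
qed

text \<open>Translates the encoding by absolute values into explicit signs; this is where
  \<open>u\<close> and \<open>v\<close> must be nonnegative.\<close>

lemma orbit_eq_signs:
  "orbit n = (\<Union>i\<in>{1, -1 :: int}. \<Union>j\<in>{1, -1 :: int}.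
     {(a, b). real_of_int a = real_of_int i * pell_u D (real n) \<and>
              real_of_int b = real_of_int j * pell_v D (real n)})"
proof -
  have "pell_u D (real n) \<ge> 0" "pell_v D (real n) \<ge> 0"
    using pell_u_pos[of n] pell_v_nonneg[of n] by auto
  then show ?thesis by (auto simp: orbit_def)
qed

end

theorem theorem2p1:
  fixes D :: nat and r :: real
  assumes "D > 0" and "\<not> is_square D" and "r > 0"
  shows "Q (pell_solutions D) r =
           (if r < 1 then {}
            else (\<Union>i\<in>{1, -1 :: int}. \<Union>j\<in>{1, -1 :: int}.
                    {(a, b). \<exists>x :: nat. real x \<le> pell_g D r \<and>
                       real_of_int a = real_of_int i * pell_u D (real x) \<and>
                       real_of_int b = real_of_int j * pell_v D (real x)}))
       \<and> int (card (Q (pell_solutions D) r)) =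
           (if r < 1 then 0 else 2 + 4 * \<lfloor>pell_g D r\<rfloor>)"
proof -
  interpret nonsquare D by standard (rule assms(2))
  show ?thesis
  proof (cases "r < 1")
    case True
    have "Q (pell_solutions D) r = {}"
    proof (rule equals0I)
      fix p assume "p \<in> Q (pell_solutions D) r"
      then obtain a b where p: "(a, b) \<in> pell_solutions D" "real_of_int (\<bar>a\<bar> + \<bar>b\<bar>) \<le> r"
        by (auto simp: Q_def)
      \<comment> \<open>Integrality leaves only the origin, which has norm 0.\<close>
      then have "\<bar>a\<bar> + \<bar>b\<bar> < 1" using True by linarith
      then have "a = 0" "b = 0" by auto
      with p(1) show False by (simp add: pell_solutions_def)
    qed
    then show ?thesis using True by simp
  next
    case False
    then have r: "r \<ge> 1" by simp
    show ?thesis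
      using False card_Q[OF r] unfolding Q_eq_orbits[OF r] orbit_eq_signs by auto
  qed
qed

end
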